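(* Let $0<\delta<1/5$, let $0<s_0<p$ be integers and let $k_0>0$. Let $A$ be a $q\times p$ real matrix such that the condition $\mathsf{RE}(s_0,3k_0,A)$ holds with $0<K(s_0,3k_0,A)<\infty$. Set $$d = s_0+s_0\,\max_{j}\|Ae_j\|_2^2\;\frac{16K^2(s_0,3k_0,A)(3k_0)^2(3k_0+1)}{\delta^2},$$ and let $E=\bigcup_{|J|\le d}E_J$ (union over $J\subset\{1,\dots,p\}$) if $d<p$, and $E=\mathbb{R}^p$ otherwise. Let $\tilde\Psi$ be a real matrix with $q$ columns such that $$\forall x\in AE:\quad (1-\delta)\|x\|_2\le\|\tilde\Psi x\|_2\le(1+\delta)\|x\|_2 .$$ Then the condition $\mathsf{RE}(s_0,k_0,\tilde\Psi A)$ holds for the matrix $\tilde\Psi A$, with $$0<K(s_0,k_0,\tilde\Psi A)\le\frac{K(s_0,k_0,A)}{1-5\delta}.$$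
   Context: $e_1,\dots,e_p$ is the canonical basis of $\mathbb{R}^p$; for $J\subset\{1,\dots,p\}$, $E_J=\mathrm{span}\{e_j:j\in J\}$, $J^c$ is the complement of $J$ in $\{1,\dots,p\}$, and $v_J$ is the restriction of $v\in\mathbb{R}^p$ to coordinates in $J$. $AE=\{Ax:x\in E\}$. Restricted Eigenvalue condition: for an integer $1\le s_0\le p$ and $k_0>0$, a matrix $A$ with $p$ columns satisfies $\mathsf{RE}(s_0,k_0,A)$ with parameter $K(s_0,k_0,A)$ if $$\frac1{K(s_0,k_0,A)}:=\min_{J\subseteq\{1,\dots,p\},\,|J|\le s_0}\ \min_{v\ne0,\ \|v_{J^c}\|_1\le k_0\|v_J\|_1}\frac{\|Av\|_2}{\|v_J\|_2}>0 .$$ *)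

theory Defs
  imports "HOL-Analysis.Analysis"
begin

(* The restriction v_J, extended by zero to an element of R^p: this leaves
   its l1 and l2 norms unchanged. *)
definition restr :: "'n::finite set \<Rightarrow> real ^ 'n \<Rightarrow> real ^ 'n" where
  "restr J v = (\<chi> i. if i \<in> J then v $ i else 0)"

definition l1norm :: "real ^ 'n::finite \<Rightarrow> real" where
  "l1norm v = (\<Sum>i\<in>UNIV. \<bar>v $ i\<bar>)"

definition RE_cone :: "real \<Rightarrow> 'p::finite set \<Rightarrow> (real ^ 'p) set" where
  "RE_cone k0 J = {v. v \<noteq> 0 \<and> l1norm (restr (- J) v) \<le> k0 * l1norm (restr J v)}"

(* The double minimum 1/K(s0,k0,A). It is taken in the extended reals because the
   inner minimum ranges over the empty set, and is then infinite, for J = {}.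
   For 1 <= s0 and k0 >= 0 the infimum is attained: see RE_min_attained. *)
definition RE_min :: "nat \<Rightarrow> real \<Rightarrow> real ^ 'p::finite ^ 'q::finite \<Rightarrow> ereal" where
  "RE_min s0 k0 A =
     (INF J\<in>{J. card J \<le> s0}. INF v\<in>RE_cone k0 J. ereal (norm (A *v v) / norm (restr J v)))"

definition RE :: "nat \<Rightarrow> real \<Rightarrow> real ^ 'p::finite ^ 'q::finite \<Rightarrow> bool" where
  "RE s0 k0 A \<longleftrightarrow> 0 < RE_min s0 k0 A"

(* In ereal, inverse 0 is infinite, so RE_K is infinite when RE fails: see RE_iff_K_finite. *)
definition RE_K :: "nat \<Rightarrow> real \<Rightarrow> real ^ 'p::finite ^ 'q::finite \<Rightarrow> ereal" where
  "RE_K s0 k0 A = inverse (RE_min s0 k0 A)"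

definition coord_span :: "'p::finite set \<Rightarrow> (real ^ 'p) set" where
  "coord_span J = span ((\<lambda>j. axis j 1) ` J)"

definition sparse_dim :: "nat \<Rightarrow> real \<Rightarrow> real \<Rightarrow> real ^ 'p::finite ^ 'q::finite \<Rightarrow> real" where
  "sparse_dim s0 k0 \<delta> A =
     real s0 + real s0 * Max (range (\<lambda>j. (norm (A *v axis j 1))\<^sup>2)) *
       (16 * (real_of_ereal (RE_K s0 (3 * k0) A))\<^sup>2 * (3 * k0)\<^sup>2 * (3 * k0 + 1) / \<delta>\<^sup>2)"

definition sparse_set :: "real \<Rightarrow> (real ^ 'p::finite) set" where
  "sparse_set d =
     (if d < real CARD('p) then (\<Union>J\<in>{J. real (card J) \<le> d}. coord_span J) else UNIV)"

lemma restr_nonzero: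
  assumes "v \<in> RE_cone k0 J"
  shows "restr J v \<noteq> 0"
proof
  assume z: "restr J v = 0"
  then have "(\<Sum>i\<in>UNIV. \<bar>restr (- J) v $ i\<bar>) \<le> 0"
    using assms by (simp add: RE_cone_def l1norm_def)
  then have "(\<Sum>i\<in>UNIV. \<bar>restr (- J) v $ i\<bar>) = 0"
    by (meson antisym sum_nonneg abs_ge_zero)
  then have n: "\<And>i. restr (- J) v $ i = 0"
    by (subst (asm) sum_nonneg_eq_0_iff) auto
  have "v $ i = 0" for i
    using n[of i] z by (cases "i \<in> J") (auto simp: restr_def vec_eq_iff split: if_splits)
  then show False
    using assms by (simp add: RE_cone_def vec_eq_iff)
qed

lemma restr_scaleR: "restr J (c *\<^sub>R v) = c *\<^sub>R restr J v"
  by (simp add: restr_def vec_eq_iff)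

lemma l1norm_scaleR: "l1norm (c *\<^sub>R v) = \<bar>c\<bar> * l1norm v"
  by (simp add: l1norm_def abs_mult sum_distrib_left)

lemma continuous_restr: "continuous_on S (restr J)"
  unfolding restr_def
proof (rule continuous_on_vec_lambda)
  show "continuous_on S (\<lambda>v. if i \<in> J then v $ i else 0)" for i
    by (cases "i \<in> J") (auto intro: continuous_intros)
qed

lemma continuous_l1norm: "continuous_on S l1norm"
  unfolding l1norm_def by (intro continuous_intros)

lemma RE_cone_min_attained:
  fixes A :: "real ^ 'p::finite ^ 'q::finite"
  assumes ne: "RE_cone k0 J \<noteq> {}"
  shows "\<exists>v\<in>RE_cone k0 J. \<forall>w\<in>RE_cone k0 J.
           norm (A *v v) / norm (restr J v) \<le> norm (A *v w) / norm (restr J w)"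
proof -
  define S where "S = sphere (0 :: real ^ 'p) 1 \<inter>
    {v. l1norm (restr (- J) v) \<le> k0 * l1norm (restr J v)}"
  have l1c: "continuous_on UNIV (\<lambda>v. l1norm (restr I v))" for I :: "'p set"
    using continuous_on_compose[OF continuous_restr continuous_l1norm] by (simp add: o_def)
  have "closed {v. l1norm (restr (- J) v) \<le> k0 * l1norm (restr J v)}"
    by (intro closed_Collect_le continuous_on_mult continuous_on_const l1c)
  then have compS: "compact S"
    unfolding S_def by (intro compact_Int_closed compact_sphere)
  have S_cone: "S \<subseteq> RE_cone k0 J"
    by (auto simp: S_def RE_cone_def)
  have norml: "(1 / norm w) *\<^sub>R w \<in> S"
    "norm (A *v ((1 / norm w) *\<^sub>R w)) / norm (restr J ((1 / norm w) *\<^sub>R w))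
       = norm (A *v w) / norm (restr J w)" if "w \<in> RE_cone k0 J" for w
    using that
    by (auto simp: S_def RE_cone_def restr_scaleR l1norm_scaleR matrix_vector_mult_scaleR
        divide_simps)
  have "S \<noteq> {}"
    using ne norml(1) by blast
  have "continuous_on S (\<lambda>v. norm (A *v v) / norm (restr J v))"
    using restr_nonzero S_cone
    by (intro continuous_intros continuous_restr matrix_vector_mult_linear_continuous_on) auto
  from continuous_attains_inf[OF compS \<open>S \<noteq> {}\<close> this]
  obtain v where v: "v \<in> S" "\<forall>w\<in>S. norm (A *v v) / norm (restr J v)
      \<le> norm (A *v w) / norm (restr J w)"
    by blast
  show ?thesis
    using v S_cone norml by (metis subsetD)
qed

lemma RE_min_attained:
  fixes A :: "real ^ 'p::finite ^ 'q::finite"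
  assumes "1 \<le> s0" "0 \<le> k0"
  shows "\<exists>J v. card J \<le> s0 \<and> v \<in> RE_cone k0 J \<and>
           RE_min s0 k0 A = ereal (norm (A *v v) / norm (restr J v))"
proof -
  define f where "f J v = norm (A *v v) / norm (restr J v)" for J v
  define Js where "Js = {J :: 'p set. card J \<le> s0 \<and> RE_cone k0 J \<noteq> {}}"
  obtain g where g: "\<And>J. J \<in> Js \<Longrightarrow> g J \<in> RE_cone k0 J"
    "\<And>J w. J \<in> Js \<Longrightarrow> w \<in> RE_cone k0 J \<Longrightarrow> f J (g J) \<le> f J w"
    using RE_cone_min_attained[of k0 _ A] unfolding Js_def f_def mem_Collect_eq by metis
  obtain j :: 'p where True
    by simp
  have "restr (- {j}) (axis j 1) = 0"
    by (auto simp: restr_def vec_eq_iff axis_def)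
  then have "axis j 1 \<in> RE_cone k0 {j}"
    using assms by (auto simp: RE_cone_def l1norm_def axis_eq_0_iff intro!: mult_nonneg_nonneg sum_nonneg)
  then have "Js \<noteq> {}"
    using assms by (auto simp: Js_def intro!: exI[of _ "{j}"])
  moreover have "finite Js"
    by simp
  ultimately obtain J where J: "J \<in> Js" "\<And>I. I \<in> Js \<Longrightarrow> f J (g J) \<le> f I (g I)"
    using arg_min_if_finite(1) arg_min_least[of Js _ "\<lambda>J. f J (g J)"] by metis
  have "RE_min s0 k0 A = ereal (f J (g J))"
  proof (rule antisym)
    show "RE_min s0 k0 A \<le> ereal (f J (g J))"
      unfolding RE_min_def f_def[symmetric]
      using J(1) g(1)[OF J(1)] by (intro INF_lower2[of J] INF_lower2[of "g J"]) (auto simp: Js_def)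
    show "ereal (f J (g J)) \<le> RE_min s0 k0 A"
      unfolding RE_min_def f_def[symmetric]
    proof (intro INF_greatest)
      fix I :: "'p set" and w assume "I \<in> {J. card J \<le> s0}" "w \<in> RE_cone k0 I"
      then have "I \<in> Js" "w \<in> RE_cone k0 I"
        by (auto simp: Js_def)
      then show "ereal (f J (g J)) \<le> ereal (f I w)"
        using J(2) g(2) order_trans by fastforce
    qed
  qed
  then show ?thesis
    using J(1) g(1) unfolding Js_def f_def by blast
qed

lemma RE_min_nonneg: "0 \<le> RE_min s0 k0 A"
  unfolding RE_min_def by (intro INF_greatest) auto

lemma RE_iff_K_finite: "RE s0 k0 A \<longleftrightarrow> RE_K s0 k0 A < \<infinity>"
  using RE_min_nonneg[of s0 k0 A] unfolding RE_def RE_K_def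
  by (cases "RE_min s0 k0 A") (auto simp: zero_ereal_def)

end

theory Submission
  imports Defs
begin

text \<open>For a vector \<open>v\<close> of the cone of \<open>J\<close>, the tail \<open>v\<^bsub>J\<^sup>c\<^esub>\<close> is a convex combination of the
  vectors \<open>\<plusminus> R e\<^sub>j\<close> with \<open>R = \<parallel>v\<^bsub>J\<^sup>c\<^esub>\<parallel>\<^sub>1\<close>. Average \<open>n\<close> of them (Maurey's empirical method), which
  keeps the vector \<open>d\<close>-sparse, so that the quadratic form
  \<open>Q y = \<parallel>\<Psi> A y\<parallel>\<^sup>2 - (1 - \<delta>)\<^sup>2 \<parallel>A y\<parallel>\<^sup>2\<close> is nonnegative there. Its mean differs from \<open>Q v\<close> by a
  variance term of size \<open>R\<^sup>2 max\<^sub>j \<parallel>A e\<^sub>j\<parallel>\<^sup>2 / n\<close>, since \<open>\<Psi>\<close> is also controlled on each \<open>A e\<^sub>j\<close>, and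
  the restricted eigenvalue condition makes this term small compared with \<open>\<parallel>A v\<parallel>\<^sup>2\<close>. Hence
  \<open>\<parallel>\<Psi> A v\<parallel> \<ge> (1 - 5 \<delta>) \<parallel>A v\<parallel>\<close> on the cone. If \<open>d\<close> leaves no room for samples, which happens for
  small \<open>k\<^sub>0\<close>, the tail is so small that the triangle inequality suffices.\<close>

section \<open>Averages of bilinear forms and derandomised sampling\<close>

text \<open>By bilinearity the cross terms with \<open>c\<close> average to \<open>B c \<mu>\<close>
  and \<open>B \<mu> c\<close>. The excess over the value at the mean is thus a variance that does
  not depend on \<open>c\<close>. Neither symmetry nor definiteness enters, so indefinite forms are
  covered.\<close>

lemma bilinear_convex_mean:
  fixes B :: "'a::real_vector \<Rightarrow> 'a \<Rightarrow> real" and x :: "'i \<Rightarrow> 'a"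
  assumes B: "bilinear B" and p: "sum p I = 1"
  defines "\<mu> \<equiv> \<Sum>i\<in>I. p i *\<^sub>R x i"
  shows "(\<Sum>i\<in>I. p i * B (c + x i) (c + x i)) =
    B (c + \<mu>) (c + \<mu>) + ((\<Sum>i\<in>I. p i * B (x i) (x i)) - B \<mu> \<mu>)"
proof -
  have l: "linear (B y)" and r: "linear (\<lambda>z. B z y)" for y
    using B by (auto simp: bilinear_def)
  have "B c \<mu> = (\<Sum>i\<in>I. p i * B c (x i))" and "B \<mu> c = (\<Sum>i\<in>I. p i * B (x i) c)"
    unfolding \<mu>_def by (simp_all add: linear_sum[OF l] linear_sum[OF r] linear_scale[OF l] linear_scale[OF r])
  moreover have "(\<Sum>i\<in>I. p i * B c c) = B c c"
    by (simp add: sum_distrib_right[symmetric] p)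
  ultimately show ?thesis
    by (simp add: bilinear_ladd[OF B] bilinear_radd[OF B] distrib_left sum.distrib)
qed

lemma convex_mean_le_imp_ex:
  fixes p f :: "'i \<Rightarrow> real"
  assumes "\<And>i. i \<in> I \<Longrightarrow> 0 \<le> p i" "sum p I = 1" "(\<Sum>i\<in>I. p i * f i) \<le> a"
  shows "\<exists>i\<in>I. f i \<le> a"
proof (rule ccontr)
  assume "\<not> ?thesis"
  then have gt: "a < f i" if "i \<in> I" for i
    using that by force
  have fin: "finite I"
    using assms(2) sum.infinite by fastforce
  obtain j where j: "j \<in> I" "0 < p j"
    using assms(1,2) by (metis order_le_less sum.neutral zero_neq_one)
  have "a = (\<Sum>i\<in>I. p i * a)"
    by (simp add: sum_distrib_right[symmetric] assms(2))
  also have "\<dots> < (\<Sum>i\<in>I. p i * f i)"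
    proof (rule sum_strict_mono_ex1[OF fin])
    show "\<forall>i\<in>I. p i * a \<le> p i * f i"
      using gt assms(1) by (simp add: mult_left_mono less_imp_le)
    show "\<exists>i\<in>I. p i * a < p i * f i"
      using gt j by (intro bexI[of _ j]) auto
  qed
  finally show False
    using assms(3) by simp
qed

text \<open>Derandomised Maurey sampling: the summands are picked one at a time, the remaining ones being
  replaced by their mean.\<close>

lemma maurey_sampling:
  fixes B :: "'a::real_vector \<Rightarrow> 'a \<Rightarrow> real" and p :: "'i \<Rightarrow> real" and x :: "'i \<Rightarrow> 'a"
  assumes B: "bilinear B" and p0: "\<And>i. i \<in> I \<Longrightarrow> 0 \<le> p i" and p: "sum p I = 1"
  defines "\<mu> \<equiv> \<Sum>i\<in>I. p i *\<^sub>R x i"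
  defines "V \<equiv> (\<Sum>i\<in>I. p i * B (x i) (x i)) - B \<mu> \<mu>"
  shows "\<exists>L. length L = n \<and> set L \<subseteq> I \<and>
    B (c + (\<Sum>i\<leftarrow>L. t *\<^sub>R x i)) (c + (\<Sum>i\<leftarrow>L. t *\<^sub>R x i))
      \<le> B (c + (t * n) *\<^sub>R \<mu>) (c + (t * n) *\<^sub>R \<mu>) + t\<^sup>2 * n * V"
proof (induction n arbitrary: c)
  case 0
  show ?case
    by simp
next
  case (Suc n)
  \<comment> \<open>One index is chosen while the other \<open>n\<close> picks sit at their mean.
    The induction hypothesis is then used at the offset shifted by that choice, so each pick adds
    \<open>t\<^sup>2 * V\<close>, the variance being independent of the offset.\<close>
  let ?c = "c + (t * n) *\<^sub>R \<mu>"
  have tm: "(\<Sum>i\<in>I. p i *\<^sub>R t *\<^sub>R x i) = t *\<^sub>R \<mu>"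
    by (simp add: \<mu>_def scaleR_sum_right mult.commute)
  have tV: "(\<Sum>i\<in>I. p i * B (t *\<^sub>R x i) (t *\<^sub>R x i)) - B (t *\<^sub>R \<mu>) (t *\<^sub>R \<mu>) = t\<^sup>2 * V"
    by (simp add: V_def bilinear_lmul[OF B] bilinear_rmul[OF B] power2_eq_square
        right_diff_distrib sum_distrib_left mult_ac)
  have "(\<Sum>i\<in>I. p i * B (?c + t *\<^sub>R x i) (?c + t *\<^sub>R x i))
      = B (?c + t *\<^sub>R \<mu>) (?c + t *\<^sub>R \<mu>) + t\<^sup>2 * V"
    using bilinear_convex_mean[OF B p, of ?c "\<lambda>i. t *\<^sub>R x i"] unfolding tm tV .
  then obtain i where i: "i \<in> I"
    "B (?c + t *\<^sub>R x i) (?c + t *\<^sub>R x i) \<le> B (?c + t *\<^sub>R \<mu>) (?c + t *\<^sub>R \<mu>) + t\<^sup>2 * V"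
    using convex_mean_le_imp_ex[OF p0 p, where f = "\<lambda>i. B (?c + t *\<^sub>R x i) (?c + t *\<^sub>R x i)", OF _ eq_refl]
    by blast
  obtain L where L: "length L = n" "set L \<subseteq> I"
    "B (c + t *\<^sub>R x i + (\<Sum>i\<leftarrow>L. t *\<^sub>R x i)) (c + t *\<^sub>R x i + (\<Sum>i\<leftarrow>L. t *\<^sub>R x i))
      \<le> B (c + t *\<^sub>R x i + (t * n) *\<^sub>R \<mu>) (c + t *\<^sub>R x i + (t * n) *\<^sub>R \<mu>) + t\<^sup>2 * n * V"
    using Suc.IH by blast
  have e1: "c + t *\<^sub>R x i + (t * n) *\<^sub>R \<mu> = ?c + t *\<^sub>R x i"
    and e2: "?c + t *\<^sub>R \<mu> = c + (t * Suc n) *\<^sub>R \<mu>"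
    by (simp_all add: algebra_simps)
  have "B (c + t *\<^sub>R x i + (\<Sum>i\<leftarrow>L. t *\<^sub>R x i)) (c + t *\<^sub>R x i + (\<Sum>i\<leftarrow>L. t *\<^sub>R x i))
      \<le> B (c + (t * Suc n) *\<^sub>R \<mu>) (c + (t * Suc n) *\<^sub>R \<mu>) + t\<^sup>2 * Suc n * V"
    using L(3) i(2) unfolding e1 e2 by (simp add: distrib_left distrib_right)
  then show ?case
    using L i(1) by (intro exI[of _ "i # L"]) (simp add: add.assoc)
qed

section \<open>Sparse vectors, the l1 norm and monotonicity in the cone\<close>

lemma vec_eq_sum_axis: "w = (\<Sum>j\<in>UNIV. (w $ j) *\<^sub>R axis j 1)" for w :: "real ^ 'p::finite"
  by (simp add: vec_eq_iff axis_def if_distrib cong: if_cong)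

lemma mem_coord_span:
  fixes w :: "real ^ 'p::finite"
  assumes "\<And>i. i \<notin> J \<Longrightarrow> w $ i = 0"
  shows "w \<in> coord_span J"
proof -
  have "w = (\<Sum>j\<in>J. (w $ j) *\<^sub>R axis j 1)"
    using assms by (subst vec_eq_sum_axis) (auto intro: sum.mono_neutral_right)
  then show ?thesis
    unfolding coord_span_def by (metis (no_types, lifting) span_sum span_scale span_base imageI)
qed

text \<open>Covers both branches of \<open>sparse_set\<close>, so that later arguments need not
  compare \<open>d\<close> with the dimension.\<close>

lemma mem_sparse_set:
  fixes w :: "real ^ 'p::finite"
  assumes "\<And>i. i \<notin> J \<Longrightarrow> w $ i = 0" "real (card J) \<le> d"
  shows "w \<in> sparse_set d"
  using mem_coord_span[OF assms(1)] assms(2) unfolding sparse_set_def by auto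

lemma norm_matrix_vector_le_l1norm:
  fixes A :: "real ^ 'p::finite ^ 'q::finite"
  assumes "\<And>j. norm (A *v axis j 1) \<le> c"
  shows "norm (A *v w) \<le> c * l1norm w"
proof -
  have "A *v w = (\<Sum>j\<in>UNIV. (w $ j) *\<^sub>R (A *v axis j 1))"
    by (subst vec_eq_sum_axis[of w])
      (simp add: linear_sum[OF matrix_vector_mul_linear] matrix_vector_mult_scaleR)
  then have "norm (A *v w) \<le> (\<Sum>j\<in>UNIV. norm ((w $ j) *\<^sub>R (A *v axis j 1)))"
    by (metis norm_sum)
  also have "\<dots> \<le> (\<Sum>j\<in>UNIV. c * \<bar>w $ j\<bar>)"
    using assms by (intro sum_mono) (simp add: mult.commute[of c] mult_left_mono)
  finally show ?thesis
    by (simp add: l1norm_def sum_distrib_left)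
qed

lemma l1norm_restr: "l1norm (restr J v) = (\<Sum>j\<in>J. \<bar>v $ j\<bar>)"
  by (simp add: l1norm_def restr_def if_distrib[of abs] sum.If_cases)

lemma l1norm_nonneg: "0 \<le> l1norm v"
  by (simp add: l1norm_def sum_nonneg)

lemma restr_add_restr_Compl: "restr J v + restr (- J) v = v"
  by (simp add: restr_def vec_eq_iff)

text \<open>Cauchy-Schwarz on the coordinates in \<open>J\<close>.\<close>

lemma l1norm_restr_le_norm: "(l1norm (restr J v))\<^sup>2 \<le> real (card J) * (norm (restr J v))\<^sup>2"
proof -
  have "(\<Sum>j\<in>J. \<bar>v $ j\<bar>)\<^sup>2 \<le> (\<Sum>j\<in>J. \<bar>v $ j\<bar>\<^sup>2) * real (card J)"
    by (rule sum_squared_le_sum_of_squares)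
  moreover have "(norm (restr J v))\<^sup>2 = (\<Sum>j\<in>J. \<bar>v $ j\<bar>\<^sup>2)"
    by (simp add: norm_vec_def L2_set_def sum_nonneg restr_def if_distrib[of "\<lambda>x. x\<^sup>2"]
        if_distrib[of abs] sum.If_cases cong: if_cong)
  ultimately show ?thesis
    by (simp add: l1norm_restr mult.commute)
qed

lemma RE_cone_mono: "k \<le> k' \<Longrightarrow> RE_cone k J \<subseteq> RE_cone k' J"
  unfolding RE_cone_def using mult_right_mono[OF _ l1norm_nonneg] by (auto intro: order_trans)

lemma RE_min_le:
  assumes "card J \<le> s0" "v \<in> RE_cone k0 J"
  shows "RE_min s0 k0 A \<le> ereal (norm (A *v v) / norm (restr J v))"
  unfolding RE_min_def using assms by (intro INF_lower2[of J] INF_lower2[of v]) auto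

lemma RE_min_antimono: "k \<le> k' \<Longrightarrow> RE_min s0 k' A \<le> RE_min s0 k A"
  unfolding RE_min_def by (intro INF_superset_mono order_refl RE_cone_mono)

section \<open>Lower bounds for the norm of the image of a cone vector\<close>

text \<open>The sampled vector has at most \<open>card J + n\<close> nonzero coordinates, so
  \<open>sparse\<close> makes the quadratic form nonnegative there. Sampling puts its value at most
  \<open>V / n\<close> above the value at \<open>v\<close>, where the variance \<open>V\<close> is
  at most \<open>(1 + \<delta>)\<^sup>2 * (M * R)\<^sup>2\<close>.\<close>

lemma norm_lower_bound_Maurey:
  fixes A :: "real ^ 'p::finite ^ 'q::finite" and \<Psi> :: "real ^ 'q ^ 'm::finite"
    and v :: "real ^ 'p"
  assumes \<delta>: "0 \<le> \<delta>" "\<delta> \<le> 1"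
    and cols: "\<And>j. norm (A *v axis j 1) \<le> M" "\<And>j. norm (\<Psi> *v (A *v axis j 1)) \<le> (1 + \<delta>) * norm (A *v axis j 1)"
    and sparse: "\<And>w I. (\<And>i. i \<notin> I \<Longrightarrow> w $ i = 0) \<Longrightarrow> card I \<le> card J + n
        \<Longrightarrow> (1 - \<delta>) * norm (A *v w) \<le> norm (\<Psi> *v (A *v w))"
    and n: "0 < n"
  defines "R \<equiv> l1norm (restr (- J) v)"
  assumes R: "0 < R"
  shows "(1 - \<delta>)\<^sup>2 * (norm (A *v v))\<^sup>2 - (1 + \<delta>)\<^sup>2 * (M * R)\<^sup>2 / n \<le> (norm (\<Psi> *v (A *v v)))\<^sup>2"
proof -
  define B where "B y z = (\<Psi> *v (A *v y)) \<bullet> (\<Psi> *v (A *v z)) - (1 - \<delta>)\<^sup>2 * ((A *v y) \<bullet> (A *v z))" for y z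
  have B: "bilinear B"
    unfolding bilinear_def B_def
    by (auto intro!: linearI simp: matrix_vector_right_distrib matrix_vector_mult_scaleR
        inner_add_left inner_add_right algebra_simps)
  have BB: "B y y = (norm (\<Psi> *v (A *v y)))\<^sup>2 - (1 - \<delta>)\<^sup>2 * (norm (A *v y))\<^sup>2" for y
    by (simp add: B_def power2_norm_eq_inner)
  define p where "p j = \<bar>v $ j\<bar> / R" for j
  define x :: "'p \<Rightarrow> real ^ 'p" where "x j = (R * sgn (v $ j)) *\<^sub>R axis j 1" for j
  have p0: "0 \<le> p j" for j
    using R by (simp add: p_def)
  have p1: "sum p (- J) = 1"
    using R unfolding p_def R_def by (simp add: l1norm_restr sum_divide_distrib[symmetric])
  have mu: "(\<Sum>j\<in>-J. p j *\<^sub>R x j) = restr (- J) v"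
  proof -
    have "p j *\<^sub>R x j = (v $ j) *\<^sub>R axis j 1" for j
      using R by (simp add: p_def x_def mult.commute[of _ "sgn _"] sgn_mult_abs abs_mult_sgn)
    then have "(\<Sum>j\<in>-J. p j *\<^sub>R x j) = (\<Sum>j\<in>-J. (v $ j) *\<^sub>R axis j 1)"
      by (simp only:)
    also have "\<dots> = restr (- J) v"
      by (simp add: vec_eq_iff restr_def axis_def if_distrib cong: if_cong)
    finally show ?thesis .
  qed
  have M: "0 \<le> M"
    using cols(1) norm_ge_zero order_trans by blast
  \<comment> \<open>The constant is \<open>(1 + \<delta>)\<^sup>2 - (1 - \<delta>)\<^sup>2 = 4 *
    \<delta>\<close>: the upper bound on the columns limits the first part of the form.\<close>
  have Bx: "B (x j) (x j) \<le> R\<^sup>2 * (4 * \<delta> * M\<^sup>2)" for j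
  proof -
    have "B (axis j 1) (axis j 1) \<le> ((1 + \<delta>) * norm (A *v axis j 1))\<^sup>2 - (1 - \<delta>)\<^sup>2 * (norm (A *v axis j 1))\<^sup>2"
      unfolding BB using cols(2) by (simp add: power_mono)
    also have "\<dots> = 4 * \<delta> * (norm (A *v axis j 1))\<^sup>2"
      by (simp add: power2_eq_square algebra_simps)
    also have "\<dots> \<le> 4 * \<delta> * M\<^sup>2"
      using cols(1) \<delta> by (intro mult_left_mono power_mono) auto
    finally have *: "B (axis j 1) (axis j 1) \<le> 4 * \<delta> * M\<^sup>2" .
    have "B (x j) (x j) = (R * sgn (v $ j))\<^sup>2 * B (axis j 1) (axis j 1)"
      by (simp add: x_def bilinear_lmul[OF B] bilinear_rmul[OF B] power2_eq_square)
    also have "\<dots> \<le> (R * sgn (v $ j))\<^sup>2 * (4 * \<delta> * M\<^sup>2)"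
      using * by (rule mult_left_mono) simp
    also have "\<dots> \<le> R\<^sup>2 * (4 * \<delta> * M\<^sup>2)"
      using \<delta> by (intro mult_right_mono) (auto simp: sgn_if)
    finally show ?thesis .
  qed
  have "(\<Sum>j\<in>-J. p j * B (x j) (x j)) \<le> (\<Sum>j\<in>-J. p j * (R\<^sup>2 * (4 * \<delta> * M\<^sup>2)))"
    using Bx p0 by (intro sum_mono mult_left_mono)
  also have "\<dots> = R\<^sup>2 * (4 * \<delta> * M\<^sup>2)"
    by (simp add: sum_distrib_right[symmetric] p1)
  finally have V1: "(\<Sum>j\<in>-J. p j * B (x j) (x j)) \<le> R\<^sup>2 * (4 * \<delta> * M\<^sup>2)" .
  have "norm (A *v restr (- J) v) \<le> M * R"
    unfolding R_def using cols(1) by (rule norm_matrix_vector_le_l1norm)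
  then have "(1 - \<delta>)\<^sup>2 * (norm (A *v restr (- J) v))\<^sup>2 \<le> (1 - \<delta>)\<^sup>2 * (M * R)\<^sup>2"
    by (intro mult_left_mono power_mono) auto
  moreover have "0 \<le> (norm (\<Psi> *v (A *v restr (- J) v)))\<^sup>2"
    by simp
  \<comment> \<open>The form may be negative at the tail, which need not be sparse; only the
    subtracted part of the form counts, and the l1 bound controls it.\<close>
  ultimately have V2: "- B (restr (- J) v) (restr (- J) v) \<le> (1 - \<delta>)\<^sup>2 * (M * R)\<^sup>2"
    unfolding BB by linarith
  \<comment> \<open>The two bounds add up by \<open>4 * \<delta> + (1 - \<delta>)\<^sup>2 = (1 +
    \<delta>)\<^sup>2\<close>.\<close>
  have V: "(\<Sum>j\<in>-J. p j * B (x j) (x j)) - B (restr (- J) v) (restr (- J) v) \<le> (1 + \<delta>)\<^sup>2 * (M * R)\<^sup>2"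
    using V1 V2 by (simp add: power2_eq_square algebra_simps)
  \<comment> \<open>With \<open>t = 1 / n\<close> the \<open>n\<close> means sum to the whole tail,
    so the centre of the sampling is \<open>v\<close> itself.\<close>
  obtain L where L: "length L = n" "set L \<subseteq> - J"
    "B (restr J v + (\<Sum>j\<leftarrow>L. (1 / n) *\<^sub>R x j)) (restr J v + (\<Sum>j\<leftarrow>L. (1 / n) *\<^sub>R x j))
      \<le> B v v + (1 / n)\<^sup>2 * n * ((\<Sum>j\<in>-J. p j * B (x j) (x j)) - B (restr (- J) v) (restr (- J) v))"
    using maurey_sampling[OF B, where I = "- J" and p = p and x = x and n = n and c = "restr J v" and t = "1 / n"] p0 p1 n
    by (auto simp: mu restr_add_restr_Compl)
  let ?w = "restr J v + (\<Sum>j\<leftarrow>L. (1 / n) *\<^sub>R x j)"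
  have "(\<Sum>j\<leftarrow>L. (1 / n) *\<^sub>R x j) $ i = 0" if "i \<notin> set L" for i
    using that by (induction L) (auto simp: x_def axis_def)
  then have "?w $ i = 0" if "i \<notin> J \<union> set L" for i
    using that by (simp add: restr_def)
  moreover have "card (J \<union> set L) \<le> card J + n"
    using card_Un_le[of J "set L"] card_length[of L] L(1) by linarith
  ultimately have "(1 - \<delta>) * norm (A *v ?w) \<le> norm (\<Psi> *v (A *v ?w))"
    by (rule sparse)
  then have "((1 - \<delta>) * norm (A *v ?w))\<^sup>2 \<le> (norm (\<Psi> *v (A *v ?w)))\<^sup>2"
    using \<delta> by (intro power_mono) auto
  then have "0 \<le> B ?w ?w"
    by (simp add: BB power_mult_distrib)
  also note L(3)
  also have "(1 / n)\<^sup>2 * n * ((\<Sum>j\<in>-J. p j * B (x j) (x j)) - B (restr (- J) v) (restr (- J) v))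
      \<le> (1 / n)\<^sup>2 * n * ((1 + \<delta>)\<^sup>2 * (M * R)\<^sup>2)"
    using V by (intro mult_left_mono) auto
  also have "\<dots> = (1 + \<delta>)\<^sup>2 * (M * R)\<^sup>2 / n"
    using n by (simp add: power2_eq_square)
  finally show ?thesis
    by (simp add: BB)
qed

text \<open>The triangle inequality is used once before and once after applying
  \<open>\<Psi>\<close>. The constant is exact: \<open>(1 - \<delta>) * (1 - \<delta> / 2) - (1 +
  \<delta>) * \<delta> / 2 = 1 - 2 * \<delta>\<close>.\<close>

lemma norm_lower_bound_small_tail:
  fixes A :: "real ^ 'p::finite ^ 'q::finite" and \<Psi> :: "real ^ 'q ^ 'm::finite"
  assumes \<delta>: "0 \<le> \<delta>" "\<delta> \<le> 1"
    and head: "(1 - \<delta>) * norm (A *v restr J v) \<le> norm (\<Psi> *v (A *v restr J v))"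
    and tail: "norm (A *v restr (- J) v) \<le> \<delta> / 2 * norm (A *v v)"
      "norm (\<Psi> *v (A *v restr (- J) v)) \<le> (1 + \<delta>) * (\<delta> / 2 * norm (A *v v))"
  shows "(1 - 2 * \<delta>) * norm (A *v v) \<le> norm (\<Psi> *v (A *v v))"
proof -
  have Av: "A *v v = A *v restr J v + A *v restr (- J) v"
    by (simp add: matrix_vector_right_distrib[symmetric] restr_add_restr_Compl)
  have \<Psi>v: "\<Psi> *v (A *v v) = \<Psi> *v (A *v restr J v) + \<Psi> *v (A *v restr (- J) v)"
    by (simp add: Av matrix_vector_right_distrib)
  have "norm (A *v v) \<le> norm (A *v restr J v) + \<delta> / 2 * norm (A *v v)"
    using tail(1) norm_triangle_ineq[of "A *v restr J v" "A *v restr (- J) v"] unfolding Av[symmetric] by linarith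
  then have "(1 - \<delta>) * (norm (A *v v) - \<delta> / 2 * norm (A *v v)) \<le> (1 - \<delta>) * norm (A *v restr J v)"
    using \<delta> by (intro mult_left_mono) auto
  also note head
  also have "norm (\<Psi> *v (A *v restr J v)) \<le> norm (\<Psi> *v (A *v v)) + (1 + \<delta>) * (\<delta> / 2 * norm (A *v v))"
    using tail(2) norm_triangle_ineq4[of "\<Psi> *v (A *v v)" "\<Psi> *v (A *v restr (- J) v)"]
    by (simp add: \<Psi>v)
  finally show ?thesis
    by (simp add: field_simps)
qed

text \<open>The tail is measured by \<open>sqrt b * R\<close>. If this is at most
  \<open>\<delta> / 2 * N\<close>, the triangle inequality suffices; otherwise \<open>bR\<close>
  forces \<open>m > 4\<close>, which leaves enough room to sample.\<close>

lemma near_isometry_RE_cone: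
  fixes A :: "real ^ 'p::finite ^ 'q::finite" and \<Psi> :: "real ^ 'q ^ 'm::finite"
  assumes \<delta>: "0 < \<delta>" "\<delta> < 1 / 5" and k0: "0 < k0" and s0: "0 < s0" and RE: "RE s0 (3 * k0) A"
    and iso: "\<forall>x \<in> (\<lambda>v. A *v v) ` sparse_set (sparse_dim s0 k0 \<delta> A).
           (1 - \<delta>) * norm x \<le> norm (\<Psi> *v x) \<and> norm (\<Psi> *v x) \<le> (1 + \<delta>) * norm x"
    and J: "card J \<le> s0" and v: "v \<in> RE_cone k0 J"
  shows "(1 - 5 * \<delta>) * norm (A *v v) \<le> norm (\<Psi> *v (A *v v))"
proof -
  define b where "b = Max (range (\<lambda>j. (norm (A *v axis j 1))\<^sup>2))"
  define R where "R = l1norm (restr (- J) v)"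
  define N where "N = norm (A *v v)"
  obtain r where r: "RE_min s0 (3 * k0) A = ereal r"
    using RE_min_attained[of s0 "3 * k0" A] s0 k0 by auto
  then have r0: "0 < r"
    using RE by (simp add: RE_def zero_ereal_def)
  \<comment> \<open>The number of coordinates, not necessarily an integer, that the sparsity level
    allows beyond \<open>s0\<close>; \<open>1 / r\<close> is \<open>K(s0, 3 k0, A)\<close>.\<close>
  define m where "m = real s0 * b * (16 * (1 / r)\<^sup>2 * (3 * k0)\<^sup>2 * (3 * k0 + 1) / \<delta>\<^sup>2)"
  have dim: "sparse_dim s0 k0 \<delta> A = s0 + m"
    using r0 by (simp add: sparse_dim_def m_def b_def RE_K_def r divide_inverse)
  have bcol: "(norm (A *v axis j 1))\<^sup>2 \<le> b" for j
    unfolding b_def by (intro Max_ge) auto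
  then have b0: "0 \<le> b"
    using zero_le_power2 order_trans by blast
  have cols: "norm (A *v axis j 1) \<le> sqrt b" for j
    using bcol real_le_rsqrt by blast
  have m0: "0 \<le> m"
    using b0 k0 by (simp add: m_def)
  have iso': "(1 - \<delta>) * norm (A *v w) \<le> norm (\<Psi> *v (A *v w))"
    "norm (\<Psi> *v (A *v w)) \<le> (1 + \<delta>) * norm (A *v w)"
    if "\<And>i. i \<notin> I \<Longrightarrow> w $ i = 0" "real (card I) \<le> s0 + m" for w I
    using iso mem_sparse_set[of I w, OF that] unfolding dim by auto
  \<comment> \<open>A singleton support is admissible because \<open>s0\<close> is at least
    1.\<close>
  have \<Psi>cols: "norm (\<Psi> *v (A *v axis j 1)) \<le> (1 + \<delta>) * norm (A *v axis j 1)" for j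
    using s0 m0 by (intro iso'(2)[of "{j}"]) (auto simp: axis_def)
  have R0: "0 \<le> R"
    by (simp add: R_def l1norm_nonneg)
  have N0: "0 \<le> N"
    by (simp add: N_def)
  have bR: "b * R\<^sup>2 \<le> m * \<delta>\<^sup>2 / 16 * N\<^sup>2"
  proof -
    have v3: "v \<in> RE_cone (3 * k0) J"
      using v RE_cone_mono[of k0 "3 * k0" J] k0 by auto
    have "0 < norm (restr J v)"
      using restr_nonzero[OF v] by simp
    moreover have "r \<le> norm (A *v v) / norm (restr J v)"
      using RE_min_le[OF J v3, of A] r by simp
    ultimately have "norm (restr J v) \<le> N / r"
      using r0 by (simp add: N_def field_simps)
    then have "(norm (restr J v))\<^sup>2 \<le> (N / r)\<^sup>2"
      by (intro power_mono) auto
    then have "real (card J) * (norm (restr J v))\<^sup>2 \<le> real s0 * (N / r)\<^sup>2"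
      using J by (intro mult_mono) auto
    then have l1: "(l1norm (restr J v))\<^sup>2 \<le> real s0 * (N / r)\<^sup>2"
      using l1norm_restr_le_norm order_trans by blast
    have "R\<^sup>2 \<le> (k0 * l1norm (restr J v))\<^sup>2"
      using v R0 by (intro power_mono) (auto simp: RE_cone_def R_def)
    also have "\<dots> \<le> k0\<^sup>2 * (real s0 * (N / r)\<^sup>2)"
      using l1 by (simp add: power_mult_distrib mult_left_mono)
    finally have "b * R\<^sup>2 \<le> b * (k0\<^sup>2 * (real s0 * (N / r)\<^sup>2)) * 1"
      using b0 by (simp add: mult_left_mono)
    \<comment> \<open>The factor \<open>9 * (3 * k0 + 1)\<close>, at least 1, brings the bound into
      the shape of \<open>m\<close>, which contains
      \<open>(3 * k0)\<^sup>2 * (3 * k0 + 1)\<close>.\<close>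
    also have "\<dots> \<le> b * (k0\<^sup>2 * (real s0 * (N / r)\<^sup>2)) * (9 * (3 * k0 + 1))"
      using b0 k0 by (intro mult_left_mono) auto
    also have "\<dots> = m * \<delta>\<^sup>2 / 16 * N\<^sup>2"
      using \<delta> r0 by (simp add: m_def field_simps power2_eq_square)
    finally show ?thesis .
  qed
  show ?thesis
  proof (cases "sqrt b * R \<le> \<delta> / 2 * N")
    case True
    have "norm (A *v restr (- J) v) \<le> sqrt b * R"
      unfolding R_def using cols by (rule norm_matrix_vector_le_l1norm)
    moreover have "norm (\<Psi> *v (A *v restr (- J) v)) \<le> ((1 + \<delta>) * sqrt b) * R"
      unfolding R_def matrix_vector_mul_assoc
    proof (rule norm_matrix_vector_le_l1norm)
      show "norm ((\<Psi> ** A) *v axis j 1) \<le> (1 + \<delta>) * sqrt b" for j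
        using order_trans[OF \<Psi>cols[of j] mult_left_mono[OF cols[of j], of "1 + \<delta>"]] \<delta>
        by (simp add: matrix_vector_mul_assoc[symmetric])
    qed
    moreover have "(1 - \<delta>) * norm (A *v restr J v) \<le> norm (\<Psi> *v (A *v restr J v))"
      using J m0 by (intro iso'(1)[of J]) (auto simp: restr_def)
    moreover have "(1 + \<delta>) * sqrt b * R \<le> (1 + \<delta>) * (\<delta> / 2 * N)"
      unfolding mult.assoc[of "1 + \<delta>" "sqrt b"] using True \<delta> by (intro mult_left_mono) auto
    ultimately have "(1 - 2 * \<delta>) * N \<le> norm (\<Psi> *v (A *v v))"
      unfolding N_def using True[unfolded N_def] \<delta>
      by (intro norm_lower_bound_small_tail[of \<delta> A J]; linarith)
    moreover have "(1 - 5 * \<delta>) * N \<le> (1 - 2 * \<delta>) * N"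
      using \<delta> N0 by (intro mult_right_mono) auto
    ultimately show ?thesis
      by (simp add: N_def)
  next
    case False
    then have gt: "\<delta> / 2 * N < sqrt b * R"
      by simp
    then have "(\<delta> / 2 * N)\<^sup>2 < (sqrt b * R)\<^sup>2"
      using \<delta> N0 by (intro power_strict_mono) auto
    then have sq: "\<delta>\<^sup>2 * N\<^sup>2 / 4 < b * R\<^sup>2"
      using b0 by (simp add: power_mult_distrib power_divide)
    \<comment> \<open>Chains \<open>sq\<close> with \<open>bR\<close>. Strictness rules out
      \<open>N = 0\<close>, so the common factor cancels.\<close>
    then have "\<delta>\<^sup>2 * N\<^sup>2 * 4 < \<delta>\<^sup>2 * N\<^sup>2 * m"
      using bR by (simp add: algebra_simps)
    then have m4: "4 < m"
      by (simp add: mult_less_cancel_left)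
    have Rpos: "0 < R"
      using gt \<delta> N0 R0 b0 by (metis less_eq_real_def mult_zero_right not_less mult_nonneg_nonneg divide_nonneg_pos zero_less_numeral)
    \<comment> \<open>Rounding down keeps the support within \<open>s0 + m\<close>; as
      \<open>m > 4\<close>, it loses at most half of \<open>m\<close>.\<close>
    define n where "n = nat \<lfloor>m\<rfloor>"
    have n: "real n \<le> m" "m / 2 \<le> real n" "0 < n"
      using m4 unfolding n_def by linarith+
    have "(1 - \<delta>)\<^sup>2 * N\<^sup>2 - (1 + \<delta>)\<^sup>2 * (sqrt b * R)\<^sup>2 / n \<le> (norm (\<Psi> *v (A *v v)))\<^sup>2"
      unfolding N_def R_def
    proof (rule norm_lower_bound_Maurey)
      show "(1 - \<delta>) * norm (A *v w) \<le> norm (\<Psi> *v (A *v w))"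
        if "\<And>i. i \<notin> I \<Longrightarrow> w $ i = 0" "card I \<le> card J + n" for w I
        using that J n by (intro iso'(1)[of I]) auto
    qed (use \<delta> cols \<Psi>cols n Rpos R_def in auto)
    moreover have "(1 + \<delta>)\<^sup>2 * (sqrt b * R)\<^sup>2 / n \<le> (1 + \<delta>)\<^sup>2 * (\<delta>\<^sup>2 / 8) * N\<^sup>2"
    proof -
      have "(sqrt b * R)\<^sup>2 \<le> m / 2 * (\<delta>\<^sup>2 / 8 * N\<^sup>2)"
        using bR b0 by (simp add: power_mult_distrib)
      also have "\<dots> \<le> n * (\<delta>\<^sup>2 / 8 * N\<^sup>2)"
        using n by (intro mult_right_mono) auto
      finally have "(sqrt b * R)\<^sup>2 / n \<le> \<delta>\<^sup>2 / 8 * N\<^sup>2"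
        using n by (simp add: field_simps)
      then have "(1 + \<delta>)\<^sup>2 * ((sqrt b * R)\<^sup>2 / n) \<le> (1 + \<delta>)\<^sup>2 * (\<delta>\<^sup>2 / 8 * N\<^sup>2)"
        by (rule mult_left_mono) simp
      then show ?thesis
        by (simp add: mult.assoc)
    qed
    moreover have "(1 - 5 * \<delta>)\<^sup>2 * N\<^sup>2 \<le> ((1 - \<delta>)\<^sup>2 - (1 + \<delta>)\<^sup>2 * (\<delta>\<^sup>2 / 8)) * N\<^sup>2"
    proof (rule mult_right_mono)
      have "(1 + \<delta>)\<^sup>2 * (\<delta>\<^sup>2 / 8) \<le> 2\<^sup>2 * (\<delta>\<^sup>2 / 8)"
        using \<delta> by (intro mult_right_mono power_mono) auto
      \<comment> \<open>The left side is \<open>\<delta>\<^sup>2 / 2\<close>, and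
        \<open>\<delta> < 1 / 5\<close> keeps \<open>1 - 3 * \<delta>\<close> above
        \<open>2 / 5\<close>.\<close>
      also have "\<dots> \<le> 8 * \<delta> * (1 - 3 * \<delta>)"
        using \<delta> mult_strict_left_mono[OF \<delta>(2) \<delta>(1)] by (simp add: power2_eq_square algebra_simps)
      also have "\<dots> = (1 - \<delta>)\<^sup>2 - (1 - 5 * \<delta>)\<^sup>2"
        by (simp add: power2_eq_square algebra_simps)
      finally show "(1 - 5 * \<delta>)\<^sup>2 \<le> (1 - \<delta>)\<^sup>2 - (1 + \<delta>)\<^sup>2 * (\<delta>\<^sup>2 / 8)"
        by simp
    qed simp
    ultimately have "((1 - 5 * \<delta>) * N)\<^sup>2 \<le> (norm (\<Psi> *v (A *v v)))\<^sup>2"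
      unfolding power_mult_distrib[of "1 - 5 * \<delta>"] left_diff_distrib[of _ _ "N\<^sup>2"] by linarith
    then show ?thesis
      unfolding N_def by (rule power2_le_imp_le) simp
  qed
qed

section \<open>Transfer of the restricted eigenvalue condition\<close>

theorem theorem1p3:
  fixes A :: "real ^ 'p::finite ^ 'q::finite"
    and \<Psi> :: "real ^ 'q::finite ^ 'm::finite"
    and s0 :: nat
    and k0 \<delta> :: real
  assumes "0 < \<delta>" and "\<delta> < 1 / 5"
    and "0 < s0" and "s0 < CARD('p)"
    and "0 < k0"
    and "RE s0 (3 * k0) A"
    and "0 < RE_K s0 (3 * k0) A" and "RE_K s0 (3 * k0) A < \<infinity>"
    and "\<forall>x \<in> (\<lambda>v. A *v v) ` sparse_set (sparse_dim s0 k0 \<delta> A).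
           (1 - \<delta>) * norm x \<le> norm (\<Psi> *v x) \<and> norm (\<Psi> *v x) \<le> (1 + \<delta>) * norm x"
  shows "RE s0 k0 (\<Psi> ** A) \<and>
         0 < RE_K s0 k0 (\<Psi> ** A) \<and>
         RE_K s0 k0 (\<Psi> ** A) \<le> RE_K s0 k0 A / ereal (1 - 5 * \<delta>)"
proof -
  obtain a where a: "RE_min s0 k0 A = ereal a"
    using RE_min_attained[of s0 k0 A] assms(3,5) by auto
  \<comment> \<open>Since the minimum for \<open>\<Psi> ** A\<close> is attained, the near isometry
    is needed at this one vector only, and the rest is real arithmetic.\<close>
  obtain J v where Jv: "card J \<le> s0" "v \<in> RE_cone k0 J"
    and \<Psi>A: "RE_min s0 k0 (\<Psi> ** A) = ereal (norm ((\<Psi> ** A) *v v) / norm (restr J v))"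
    using RE_min_attained[of s0 k0 "\<Psi> ** A"] assms(3,5) by auto
  define c where "c = norm ((\<Psi> ** A) *v v) / norm (restr J v)"
  \<comment> \<open>The cone for \<open>k0\<close> lies in the cone for \<open>3 * k0\<close>, so
    its minimum is at least as large.\<close>
  have "0 < RE_min s0 k0 A"
    using assms(5,6) RE_min_antimono[of k0 "3 * k0" s0 A] by (auto simp: RE_def)
  then have a0: "0 < a"
    by (simp add: a zero_ereal_def)
  have "a \<le> norm (A *v v) / norm (restr J v)"
    using RE_min_le[OF Jv, of A] by (simp add: a)
  then have "(1 - 5 * \<delta>) * a \<le> (1 - 5 * \<delta>) * (norm (A *v v) / norm (restr J v))"
    using assms(2) by (intro mult_left_mono) auto
  also have "\<dots> \<le> c"
    unfolding c_def times_divide_eq_right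
    using near_isometry_RE_cone[OF assms(1,2,5,3,6,9) Jv]
    by (intro divide_right_mono) (auto simp: matrix_vector_mul_assoc)
  finally have ac: "(1 - 5 * \<delta>) * a \<le> c" .
  have pos: "0 < (1 - 5 * \<delta>) * a"
    using a0 assms(2) by simp
  then have c0: "0 < c"
    using ac by linarith
  have "1 / c \<le> 1 / ((1 - 5 * \<delta>) * a)"
    using ac pos by (intro divide_left_mono mult_pos_pos[OF c0 pos]) simp_all
  then have "inverse c \<le> inverse a / (1 - 5 * \<delta>)"
    by (simp add: field_simps)
  then show ?thesis
    using a0 c0 assms(2) \<Psi>A[folded c_def] a by (simp add: RE_def RE_K_def zero_ereal_def)
qed

end
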